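(* Let $d_1,d_2\ge 1$ be integers and let $\Gamma$ and $\Delta$ be finite simple graphs. If $\Gamma$ and $\Delta$ are $d_1$-measurement isomorphic, then they are $d_2$-measurement isomorphic.
   Context: A graph $\Gamma$ consists of a finite set $\mathcal{V}(\Gamma)$ of $v$ vertices and a set $\mathcal{E}(\Gamma)$ of $e$ edges, where $\mathcal{E}(\Gamma)$ is a set of two-element subsets of $\mathcal{V}(\Gamma)$. $\mathbb{E}^d$ is $d$-dimensional Euclidean space. $C^d(\mathcal{V})$ is the set of configurations of $\mathcal{V}$ in $\mathbb{E}^d$, i.e. of all maps $p:\mathcal{V}\to\mathbb{E}^d$ (not required to be injective). Once an identification of the edges of $\Gamma$ with the coordinate axes of $\mathbb{R}^e$ is fixed, the length-squared function $\ell_\Gamma:C^d(\mathcal{V}(\Gamma))\to\mathbb{R}^e$ sends $p$ to the vector whose coordinate for the edge $\{u,w\}$ is $|p(u)-p(w)|^2$. The $d$-dimensional measurement set $M_d(\Gamma)\subset\mathbb{R}^e$ is the image of $\ell_\Gamma$. Two graphs $\Gamma,\Delta$, both with $e$ edges, are $d$-measurement isomorphic if there are an identification of the edges of $\Gamma$ with the coordinate axes of $\mathbb{R}^e$ and an identification of the edges of $\Delta$ with the coordinate axes of $\mathbb{R}^e$ under which $M_d(\Gamma)=M_d(\Delta)$. (Graphs with different numbers of edges are not $d$-measurement isomorphic.) *)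

theory Defs
  imports "HOL-Analysis.Analysis"
begin

record 'v ugraph =
  verts :: "'v set"
  edges :: "'v set set"

definition finite_simple_graph :: "'v ugraph \<Rightarrow> bool" where
  "finite_simple_graph G \<longleftrightarrow>
     finite (verts G) \<and> edges G \<subseteq> {A. A \<subseteq> verts G \<and> card A = 2}"

text \<open>
  The space \<open>\<real>\<^sup>e\<close> is rendered as the extensional functions on \<open>{..<e}\<close>, since \<open>e\<close> depends on
  the graph. The dimension \<open>d \<ge> 1\<close> of the ambient Euclidean space is \<open>CARD('d)\<close>.
\<close>

definition configurations :: "'v set \<Rightarrow> ('v \<Rightarrow> real ^ 'd) set" where
  "configurations V = V \<rightarrow>\<^sub>E UNIV"

text \<open>Only meaningful when \<open>A\<close> is a two-element set; see the lemma below.\<close>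

definition sq_length :: "('v \<Rightarrow> real ^ 'd) \<Rightarrow> 'v set \<Rightarrow> real" where
  "sq_length p A = (THE r. \<exists>u w. A = {u, w} \<and> r = (norm (p u - p w))\<^sup>2)"

lemma sq_length_doubleton: "sq_length p {u, w} = (norm (p u - p w))\<^sup>2"
  unfolding sq_length_def
  by (rule the_equality) (auto simp: doubleton_eq_iff norm_minus_commute)

definition edge_labelling :: "'v ugraph \<Rightarrow> (nat \<Rightarrow> 'v set) \<Rightarrow> bool" where
  "edge_labelling G \<sigma> \<longleftrightarrow> bij_betw \<sigma> {..<card (edges G)} (edges G)"

definition length_squared ::
    "'v ugraph \<Rightarrow> (nat \<Rightarrow> 'v set) \<Rightarrow> ('v \<Rightarrow> real ^ 'd) \<Rightarrow> nat \<Rightarrow> real" where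
  "length_squared G \<sigma> p = (\<lambda>i\<in>{..<card (edges G)}. sq_length p (\<sigma> i))"

definition measurement_set ::
    "'d::finite itself \<Rightarrow> 'v ugraph \<Rightarrow> (nat \<Rightarrow> 'v set) \<Rightarrow> (nat \<Rightarrow> real) set" where
  "measurement_set (_ :: 'd::finite itself) G \<sigma> =
     length_squared G \<sigma> ` (configurations (verts G) :: ('v \<Rightarrow> real ^ 'd::finite) set)"

definition measurement_isomorphic ::
    "'d::finite itself \<Rightarrow> 'v ugraph \<Rightarrow> 'w ugraph \<Rightarrow> bool" where
  "measurement_isomorphic D G H \<longleftrightarrow>
     card (edges G) = card (edges H) \<and>
     (\<exists>\<sigma> \<tau>. edge_labelling G \<sigma> \<and> edge_labelling H \<tau> \<and>
            measurement_set D G \<sigma> = measurement_set D H \<tau>)"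

end

theory Submission imports Defs begin

text \<open>
  Every finite graph \<open>\<Gamma>\<close> has a spanning forest, rooted so that each edge joins a vertex to one of its
  ancestors (a depth-first search forest). Prescribing the edge vectors \<open>c z\<close> along
  the tree edges freely, the vector of any other edge is the plain sum of \<open>c z\<close> over the
  monotone tree path \<open>P i\<close> below it. Giving all tree edges the same unit vector makes the
  triangle inequality sharp along each of these paths. A configuration of \<open>\<Delta>\<close> with the
  same lengths must then be straight along the corresponding edges, which forces the linear relations
  between the edge vectors of \<open>\<Delta>\<close> to be those of \<open>\<Gamma>\<close> up to one global choice of edge signs.
  Sign changes do not affect lengths, in any dimension.
\<close>

section \<open>Depth-first search forests\<close>

text \<open>\<open>A v\<close> lists the vertices on the path from \<open>v\<close> to the root of its tree.\<close>

definition path_forest :: "'v set \<Rightarrow> 'v set set \<Rightarrow> ('v \<Rightarrow> 'v list) \<Rightarrow> bool" where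
  "path_forest V E A \<longleftrightarrow>
     (\<forall>v\<in>V. A v = [v] \<or> (\<exists>w\<in>V. {v, w} \<in> E \<and> A v = v # A w))"

lemma path_forest_Cons: "path_forest V E A \<Longrightarrow> v \<in> V \<Longrightarrow> \<exists>l. A v = v # l"
  unfolding path_forest_def by blast

text \<open>No clause of \<open>path_forest\<close> forbids cycles; the finite lists do. The list of
  \<open>v\<close> is one longer than that of its parent, so induction on
  \<open>length (A v)\<close> climbs to the root, and the list of an ancestor is a tail.\<close>

lemma path_forest_split:
  assumes "path_forest V E A" "v \<in> V" "u \<in> set (A v)"
  shows "u \<in> V \<and> A v = takeWhile (\<lambda>x. x \<noteq> u) (A v) @ A u"
  using assms(2,3)
proof (induction "length (A v)" arbitrary: v rule: less_induct)
  case less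
  consider "A v = [v]" | w where "w \<in> V" "A v = v # A w"
    using assms(1) less.prems unfolding path_forest_def by blast
  then show ?case
  proof cases
    case 1
    then show ?thesis using less.prems by auto
  next
    case 2
    show ?thesis
    proof (cases "u = v")
      case True
      then show ?thesis using less.prems 2 by auto
    next
      case False
      then have "u \<in> V \<and> A w = takeWhile (\<lambda>x. x \<noteq> u) (A w) @ A u"
        using less.hyps[of w] less.prems 2 by auto
      then show ?thesis using 2 False by auto
    qed
  qed
qed

text \<open>If \<open>v\<close> recurred, it would lie on the list of its parent \<open>w\<close>,
  making \<open>A v\<close> a tail of \<open>A w\<close>, although it is one longer.\<close>

lemma path_forest_distinct:
  assumes "path_forest V E A" "v \<in> V"
  shows "distinct (A v)"
  using assms(2)
proof (induction "length (A v)" arbitrary: v rule: less_induct)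
  case less
  consider "A v = [v]" | w where "w \<in> V" "A v = v # A w"
    using assms(1) less.prems unfolding path_forest_def by blast
  then show ?case
  proof cases
    case 2
    have "v \<notin> set (A w)"
    proof
      assume "v \<in> set (A w)"
      then have "A w = takeWhile (\<lambda>x. x \<noteq> v) (A w) @ A v"
        using path_forest_split[OF assms(1) 2(1)] by blast
      then have "length (A w) \<ge> length (A v)"
        by (metis length_append le_add2)
      then show False using 2 by simp
    qed
    then show ?thesis using 2 less.hyps[of w] by simp
  qed simp
qed

lemma path_forest_length:
  assumes "path_forest V E A" "v \<in> V" "finite V"
  shows "length (A v) \<le> card V"
  using path_forest_distinct[OF assms(1,2)] path_forest_split[OF assms(1,2)] assms(3)
  by (metis card_mono distinct_card subsetI)

text \<open>Surgery: the subtree below \<open>u\<close> is cut off and hung under \<open>w\<close>.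
  Since \<open>w\<close> lies outside that subtree (\<open>nu\<close>), its own list is unchanged
  and no cycle arises.\<close>

lemma path_forest_reattach:
  assumes A: "path_forest V E A" and u: "u \<in> V" and w: "w \<in> V" and uw: "{u, w} \<in> E"
    and nu: "u \<notin> set (A w)"
  defines "A' \<equiv> \<lambda>v. if u \<in> set (A v) then takeWhile (\<lambda>x. x \<noteq> u) (A v) @ u # A w else A v"
  shows "path_forest V E A'"
  unfolding path_forest_def
proof
  fix v assume v: "v \<in> V"
  obtain l where l: "A u = u # l" using path_forest_Cons[OF A u] by blast
  show "A' v = [v] \<or> (\<exists>z\<in>V. {v, z} \<in> E \<and> A' v = v # A' z)"
  proof (cases "v = u")
    case True
    then show ?thesis using w uw nu l unfolding A'_def by auto
  next
    case False
    consider "A v = [v]" | z where "z \<in> V" "{v, z} \<in> E" "A v = v # A z"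
      using A v unfolding path_forest_def by blast
    then show ?thesis
    proof cases
      case 1
      then show ?thesis using False unfolding A'_def by simp
    next
      case 2
      then have "A' v = v # A' z" using False unfolding A'_def by auto
      then show ?thesis using 2 by blast
    qed
  qed
qed

text \<open>A forest of largest total depth works. If an edge joined two incomparable vertices,
  hanging the one that is not deeper below the other would push its whole subtree further from the
  root and move no other vertex.\<close>

lemma dfs_forest_exists:
  assumes fin: "finite V"
  shows "\<exists>A. path_forest V E A \<and>
    (\<forall>u\<in>V. \<forall>w\<in>V. {u, w} \<in> E \<longrightarrow> u \<in> set (A w) \<or> w \<in> set (A u))"
proof -
  define m where "m A = (\<Sum>v\<in>V. length (A v))" for A :: "'a \<Rightarrow> 'a list"
  have ex: "path_forest V E (\<lambda>v. [v])" unfolding path_forest_def by simp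
  have "m A < Suc (card V * card V)" if "path_forest V E A" for A
    unfolding m_def using sum_bounded_above[of V "\<lambda>v. length (A v)" "card V"]
      path_forest_length[OF that _ fin] by (simp add: less_Suc_eq_le)
  then obtain A where A: "path_forest V E A" and max: "\<And>B. path_forest V E B \<Longrightarrow> m B \<le> m A"
    using ex_has_greatest_nat[of "path_forest V E", OF ex] by metis
  have comparable: "u \<in> set (A w) \<or> w \<in> set (A u)"
    if u: "u \<in> V" and w: "w \<in> V" and uw: "{u, w} \<in> E" and le: "length (A u) \<le> length (A w)" for u w
  proof (rule ccontr)
    assume "\<not> ?thesis"
    then have nu: "u \<notin> set (A w)" by blast
    define A' where
      "A' \<equiv> \<lambda>v. if u \<in> set (A v) then takeWhile (\<lambda>x. x \<noteq> u) (A v) @ u # A w else A v"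
    have A': "path_forest V E A'"
      using path_forest_reattach[OF A u w uw nu] unfolding A'_def .
    have longer: "length (A v) < length (A' v)" if "v \<in> V" "u \<in> set (A v)" for v
    proof -
      have "A v = takeWhile (\<lambda>x. x \<noteq> u) (A v) @ A u"
        using path_forest_split[OF A that] by blast
      then have "length (A v) = length (takeWhile (\<lambda>x. x \<noteq> u) (A v)) + length (A u)"
        by (metis length_append)
      then show ?thesis using le that unfolding A'_def by simp
    qed
    have "u \<in> set (A u)" using path_forest_Cons[OF A u] by auto
    then have "m A < m A'"
      unfolding m_def using fin u longer
      by (intro sum_strict_mono_ex1) (auto simp: A'_def intro: less_imp_le)
    then show False using max[OF A'] by simp
  qed
  show ?thesis using A comparable by (metis insert_commute linear)
qed

section \<open>Tree coordinates for the edge vectors\<close>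

text \<open>
  The tree edges are indexed by the non-root vertices \<open>z \<in> N\<close> through \<open>e\<close>. The edge
  \<open>i\<close> goes from \<open>u i\<close> up to its ancestor \<open>w i\<close>, and \<open>P i\<close> indexes the tree path between them.
\<close>

lemma dfs_coordinates:
  fixes \<sigma> :: "'i \<Rightarrow> 'v set"
  assumes fin: "finite V" and bij: "bij_betw \<sigma> I E" and E: "E \<subseteq> {A. A \<subseteq> V \<and> card A = 2}"
  obtains u w :: "'i \<Rightarrow> 'v" and N :: "'v set" and P e where
    "finite N" "\<And>i. i \<in> I \<Longrightarrow> \<sigma> i = {u i, w i}"
    "\<And>i. i \<in> I \<Longrightarrow> P i \<subseteq> N"
    "\<And>z. z \<in> N \<Longrightarrow> e z \<in> I" "\<And>z. z \<in> N \<Longrightarrow> P (e z) = {z}"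
    "\<And>i (p :: 'v \<Rightarrow> real). i \<in> I \<Longrightarrow> p (u i) - p (w i) = (\<Sum>z\<in>P i. p (u (e z)) - p (w (e z)))"
    "\<And>c :: 'v \<Rightarrow> real. \<exists>p. \<forall>z\<in>N. p (u (e z)) - p (w (e z)) = c z"
proof -
  obtain A where A: "path_forest V E A"
    and comp: "\<And>u w. u \<in> V \<Longrightarrow> w \<in> V \<Longrightarrow> {u, w} \<in> E \<Longrightarrow> u \<in> set (A w) \<or> w \<in> set (A u)"
    using dfs_forest_exists[OF fin, of E] by blast
  define N where "N = {v \<in> V. A v \<noteq> [v]}"
  obtain par where par: "\<And>v. v \<in> N \<Longrightarrow> par v \<in> V \<and> {v, par v} \<in> E \<and> A v = v # A (par v)"
    using A unfolding path_forest_def N_def by (metis (mono_tags, lifting) mem_Collect_eq)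
  define e where "e z = inv_into I \<sigma> {z, par z}" for z
  have e: "e z \<in> I" "\<sigma> (e z) = {z, par z}" if "z \<in> N" for z
  proof -
    have "{z, par z} \<in> \<sigma> ` I" using par[OF that] bij by (simp add: bij_betw_def)
    then show "e z \<in> I" "\<sigma> (e z) = {z, par z}"
      unfolding e_def by (rule inv_into_into, rule f_inv_into_f)
  qed
  have Ivw: "\<exists>v w. v \<in> V \<and> w \<in> set (A v) \<and> v \<noteq> w \<and> \<sigma> i = {v, w}" if "i \<in> I" for i
  proof -
    have "\<sigma> i \<in> E" using bij that by (auto simp: bij_betw_def)
    then obtain x y where "\<sigma> i = {x, y}" "x \<noteq> y" "x \<in> V" "y \<in> V"
      using E by (force simp: card_2_iff)
    then show ?thesis using comp[of x y] \<open>\<sigma> i \<in> E\<close> by (metis insert_commute)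
  qed
  then obtain u w where uw: "\<And>i. i \<in> I \<Longrightarrow>
      u i \<in> V \<and> w i \<in> set (A (u i)) \<and> u i \<noteq> w i \<and> \<sigma> i = {u i, w i}"
    by metis
  \<comment> \<open>\<open>takeWhile\<close> stops before \<open>w i\<close>: each vertex kept
    stands for the tree edge to its parent, and the edge above \<open>w i\<close> is not on the
    path.\<close>
  define P where "P i = set (takeWhile (\<lambda>x. x \<noteq> w i) (A (u i)))" for i
  \<comment> \<open>Only the orientation is in question: the opposite one would put \<open>z\<close>
    on the list of its parent, against distinctness.\<close>
  have ue: "u (e z) = z \<and> w (e z) = par z" if z: "z \<in> N" for z
  proof -
    have d: "distinct (A z)" using path_forest_distinct[OF A] z by (simp add: N_def)
    obtain l where "A (par z) = par z # l" using path_forest_Cons[OF A] par[OF z] by blast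
    then have "z \<notin> set (A (par z))" using d par[OF z] by auto
    then show ?thesis using uw[OF e(1)[OF z]] e(2)[OF z] by (auto simp: doubleton_eq_iff)
  qed
  have PN: "P i \<subseteq> N" if i: "i \<in> I" for i
  proof
    fix z assume "z \<in> P i"
    then have z: "z \<in> set (takeWhile (\<lambda>x. x \<noteq> w i) (A (u i)))" unfolding P_def .
    then have zA: "z \<in> set (A (u i))" by (rule set_takeWhileD[THEN conjunct1])
    have "z \<noteq> w i" using z by (auto dest: set_takeWhileD)
    have uV: "u i \<in> V" and wA: "w i \<in> set (A (u i))" using uw[OF i] by auto
    have zV: "z \<in> V" using path_forest_split[OF A uV zA] by blast
    \<comment> \<open>A root \<open>z\<close> would be the last entry of \<open>A (u i)\<close>,
      hence also of its tail \<open>A (w i)\<close>; but \<open>z\<close> stands before that tail in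
      a distinct list.\<close>
    have "A z \<noteq> [z]"
    proof
      assume root: "A z = [z]"
      have s: "A (u i) = takeWhile (\<lambda>x. x \<noteq> w i) (A (u i)) @ A (w i)"
        using path_forest_split[OF A uV wA] by blast
      have wV: "w i \<in> V" using path_forest_split[OF A uV wA] by blast
      have "last (A (u i)) = z"
        using path_forest_split[OF A uV zA] root by (metis last_snoc)
      then have "last (A (w i)) = z"
        using s path_forest_Cons[OF A wV] by (metis last_appendR list.discI)
      then have "z \<in> set (A (w i))"
        using path_forest_Cons[OF A wV] by (metis last_in_set list.discI)
      moreover have "distinct (takeWhile (\<lambda>x. x \<noteq> w i) (A (u i)) @ A (w i))"
        using s path_forest_distinct[OF A uV] by simp
      ultimately show False using z by auto
    qed
    then show "z \<in> N" using zV by (simp add: N_def)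
  qed
  have Pe: "P (e z) = {z}" if z: "z \<in> N" for z
  proof -
    have "A (par z) \<noteq> [] \<and> hd (A (par z)) = par z"
      using path_forest_Cons[OF A] par[OF z] by fastforce
    then have "takeWhile (\<lambda>x. x \<noteq> par z) (A (par z)) = []"
      by (cases "A (par z)") auto
    moreover have "z \<noteq> par z"
      using uw[OF e(1)[OF z]] ue[OF z] by auto
    ultimately show ?thesis
      using par[OF z] ue[OF z] by (simp add: P_def)
  qed
  have tele: "p v - p x = (\<Sum>z\<in>set (takeWhile (\<lambda>y. y \<noteq> x) (A v)). p z - p (par z))"
    if "v \<in> V" "x \<in> set (A v)" for v x and p :: "'v \<Rightarrow> real"
    using that
  proof (induction "length (A v)" arbitrary: v rule: less_induct)
    case less
    show ?case
    proof (cases "v = x")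
      case True
      then show ?thesis using path_forest_Cons[OF A] less.prems by fastforce
    next
      case False
      then have "v \<in> N" using less.prems by (auto simp: N_def)
      note pv = par[OF this]
      have "v \<notin> set (A (par v))"
        using pv path_forest_distinct[OF A less.prems(1)] by (metis distinct.simps(2))
      then have "v \<notin> set (takeWhile (\<lambda>y. y \<noteq> x) (A (par v)))"
        by (auto dest: set_takeWhileD)
      moreover have "x \<in> set (A (par v))" using pv less.prems False by auto
      then have "p (par v) - p x = (\<Sum>z\<in>set (takeWhile (\<lambda>y. y \<noteq> x) (A (par v))). p z - p (par z))"
        using less.hyps[of "par v"] pv by simp
      ultimately show ?thesis using pv False by simp
    qed
  qed
  have sum_path: "p (u i) - p (w i) = (\<Sum>z\<in>P i. p (u (e z)) - p (w (e z)))"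
    if i: "i \<in> I" for i and p :: "'v \<Rightarrow> real"
  proof -
    have "p (u i) - p (w i) = (\<Sum>z\<in>P i. p z - p (par z))"
      using tele uw[OF i] unfolding P_def by blast
    also have "\<dots> = (\<Sum>z\<in>P i. p (u (e z)) - p (w (e z)))"
      using PN[OF i] ue by (intro sum.cong) auto
    finally show ?thesis .
  qed
  have free: "\<exists>p. \<forall>z\<in>N. p (u (e z)) - p (w (e z)) = c z" for c :: "'v \<Rightarrow> real"
  \<comment> \<open>The potential of \<open>v\<close> sums \<open>c\<close> over the tree edges
    above \<open>v\<close>. \<open>butlast\<close> drops the root, which has no edge above it, so
    roots get 0.\<close>
  proof (intro exI[of _ "\<lambda>v. sum_list (map c (butlast (A v)))"] ballI)
    fix z assume z: "z \<in> N"
    have "A (par z) \<noteq> []" using path_forest_Cons[OF A] par[OF z] by fastforce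
    then have "butlast (A z) = z # butlast (A (par z))" using par[OF z] by simp
    then show "sum_list (map c (butlast (A (u (e z))))) - sum_list (map c (butlast (A (w (e z))))) = c z"
      using ue[OF z] by simp
  qed
  have "finite N" using fin by (simp add: N_def)
  moreover have "\<sigma> i = {u i, w i}" if "i \<in> I" for i using uw[OF that] by blast
  ultimately show thesis
    by (rule that[OF _ _ PN e(1) Pe sum_path free])
qed

section \<open>Rigidity of the linear relations\<close>

text \<open>Equality case of the triangle inequality. The terms
  \<open>norm s - f x \<bullet> s\<close> are nonnegative by Cauchy-Schwarz and add up to 0, so each
  vanishes, and equality in Cauchy-Schwarz makes \<open>f z\<close> and \<open>s\<close> point the
  same way.\<close>

lemma sum_unit_vectors_eq:
  fixes f :: "'a \<Rightarrow> 'b::real_inner"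
  assumes fin: "finite S" and unit: "\<And>z. z \<in> S \<Longrightarrow> norm (f z) = 1"
    and len: "norm (sum f S) = card S" and z: "z \<in> S"
  shows "sum f S = real (card S) *\<^sub>R f z"
proof -
  define s where "s = sum f S"
  have le: "f x \<bullet> s \<le> norm s" if "x \<in> S" for x
    using norm_cauchy_schwarz[of "f x" s] unit[OF that] by simp
  have "(\<Sum>x\<in>S. norm s - f x \<bullet> s) = real (card S) * norm s - s \<bullet> s"
    by (simp add: sum_subtractf s_def inner_sum_left)
  also have "\<dots> = 0" using len by (simp add: s_def dot_square_norm power2_eq_square)
  finally have "norm s - f z \<bullet> s = 0"
    using sum_nonneg_eq_0_iff[of S "\<lambda>x. norm s - f x \<bullet> s"] fin le z by simp
  then have "norm (f z) *\<^sub>R s = norm s *\<^sub>R f z"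
    using norm_cauchy_schwarz_eq[of "f z" s] unit[OF z] by simp
  then show ?thesis using unit[OF z] len by (simp add: s_def)
qed

text \<open>An arbitrary choice of one vector out of each pair \<open>x\<close>, \<open>-x\<close>, as a sign.\<close>

definition vec_sign :: "real ^ 'd \<Rightarrow> real" where
  "vec_sign x = sgn (x $ (SOME k. x $ k \<noteq> 0))"

lemma vec_sign_scaleR: "vec_sign (r *\<^sub>R x) = sgn r * vec_sign x"
  by (cases "r = 0") (simp_all add: vec_sign_def sgn_mult)

lemma abs_vec_sign:
  assumes "x \<noteq> 0" shows "\<bar>vec_sign x\<bar> = 1"
proof -
  have "x $ (SOME k. x $ k \<noteq> 0) \<noteq> 0"
    using assms by (intro someI_ex[of "\<lambda>k. x $ k \<noteq> 0"]) (auto simp: vec_eq_iff)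
  then show ?thesis by (simp add: vec_sign_def abs_sgn_eq)
qed

text \<open>Test configurations recover the relations. A vector placed on a single tree edge gives
  the coefficients up to sign; equal unit vectors on all tree edges give the signs. The conclusion
  concerns real-valued \<open>q\<close>, so it can be applied to each coordinate in any
  dimension.\<close>

lemma relations_rigid:
  fixes a b :: "'i \<Rightarrow> 'w" and P :: "'i \<Rightarrow> 'v set"
  assumes fin: "finite N" and P: "\<And>i. i \<in> I \<Longrightarrow> P i \<subseteq> N"
    and e: "\<And>z. z \<in> N \<Longrightarrow> e z \<in> I" "\<And>z. z \<in> N \<Longrightarrow> P (e z) = {z}"
    and forth: "\<And>c :: 'v \<Rightarrow> real ^ 'd. \<exists>q :: 'w \<Rightarrow> real ^ 'd.
      \<forall>i\<in>I. norm (q (a i) - q (b i)) = norm (\<Sum>z\<in>P i. c z)"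
    and conv: "\<And>q :: 'w \<Rightarrow> real ^ 'd. \<exists>c :: 'v \<Rightarrow> real ^ 'd.
      \<forall>i\<in>I. norm (q (a i) - q (b i)) = norm (\<Sum>z\<in>P i. c z)"
  obtains \<epsilon> :: "'i \<Rightarrow> real" and \<rho> :: "'v \<Rightarrow> 'w \<Rightarrow> real" where
    "\<And>i. i \<in> I \<Longrightarrow> P i \<noteq> {} \<Longrightarrow> \<bar>\<epsilon> i\<bar> = 1"
    "\<And>z i. z \<in> N \<Longrightarrow> i \<in> I \<Longrightarrow> \<rho> z (a i) - \<rho> z (b i) = (if z \<in> P i then \<epsilon> i * \<epsilon> (e z) else 0)"
    "\<And>(q :: 'w \<Rightarrow> real) i. i \<in> I \<Longrightarrow>
       q (a i) - q (b i) = \<epsilon> i * (\<Sum>z\<in>P i. \<epsilon> (e z) * (q (a (e z)) - q (b (e z))))"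
proof -
  define D where "D q i = q (a i) - q (b i)" for q :: "'w \<Rightarrow> real ^ 'd" and i
  define h :: "real ^ 'd" where "h = axis undefined 1"
  have h: "norm h = 1" by (simp add: h_def)
  have finP: "finite (P i)" if "i \<in> I" for i using fin P[OF that] by (rule finite_subset[rotated])
  \<comment> \<open>Since \<open>P (e z) = {z}\<close>, the matching \<open>c\<close> vanishes on
    all of \<open>N\<close>, and so does every path sum.\<close>
  have vanish: "D q i = 0" if "\<And>z. z \<in> N \<Longrightarrow> D q (e z) = 0" "i \<in> I" for q i
  proof -
    obtain c :: "'v \<Rightarrow> real ^ 'd" where c: "\<And>i. i \<in> I \<Longrightarrow> norm (D q i) = norm (\<Sum>z\<in>P i. c z)"
      using conv[of q] unfolding D_def by blast
    have "c z = 0" if "z \<in> N" for z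
      using c[OF e(1)] e(2) that \<open>\<And>z. z \<in> N \<Longrightarrow> D q (e z) = 0\<close> by simp
    then have "(\<Sum>z\<in>P i. c z) = 0" using P[OF \<open>i \<in> I\<close>] by (intro sum.neutral) auto
    then show ?thesis using c[OF \<open>i \<in> I\<close>] by simp
  qed
  \<comment> \<open>\<open>r\<close> is a potential dual to the tree edge \<open>e z\<close>. It
    comes from the configuration matching the vector \<open>h\<close> on \<open>z\<close> and 0
    elsewhere, projected onto its edge vector \<open>y\<close> at \<open>e z\<close>. Removing the
    \<open>y\<close> component kills all tree edges, hence all edges by \<open>vanish\<close>, so
    the projection loses no length.\<close>
  have "\<exists>r :: 'w \<Rightarrow> real. (\<forall>z'\<in>N. r (a (e z')) - r (b (e z')) = (if z' = z then 1 else 0)) \<and>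
      (\<forall>i\<in>I. \<bar>r (a i) - r (b i)\<bar> = (if z \<in> P i then 1 else 0))" if z: "z \<in> N" for z
  proof -
    obtain q where q: "\<And>i. i \<in> I \<Longrightarrow> norm (D q i) = norm (\<Sum>x\<in>P i. if x = z then h else 0)"
      using forth[of "\<lambda>x. if x = z then h else 0"] unfolding D_def by blast
    have nq: "norm (D q i) = (if z \<in> P i then 1 else 0)" if "i \<in> I" for i
      using q[OF that] finP[OF that] h by (simp add: sum.delta)
    define y where "y = D q (e z)"
    have ny: "norm y = 1" using nq[OF e(1)[OF z]] e(2)[OF z] by (simp add: y_def)
    define r where "r v = q v \<bullet> y" for v
    have r: "r (a i) - r (b i) = D q i \<bullet> y" for i by (simp add: r_def D_def inner_diff_left)
    have tree: "r (a (e z')) - r (b (e z')) = (if z' = z then 1 else 0)" if "z' \<in> N" for z'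
      using nq[OF e(1)[OF that]] e(2)[OF that] ny unfolding r
      by (auto simp: y_def dot_square_norm split: if_splits)
    have Ds: "D (\<lambda>v. q v - r v *\<^sub>R y) i = D q i - (r (a i) - r (b i)) *\<^sub>R y" for i
      by (simp add: D_def algebra_simps)
    have "D (\<lambda>v. q v - r v *\<^sub>R y) i = 0" if "i \<in> I" for i
    proof (rule vanish[OF _ that])
      fix z' assume z': "z' \<in> N"
      show "D (\<lambda>v. q v - r v *\<^sub>R y) (e z') = 0"
        unfolding Ds tree[OF z'] using nq[OF e(1)[OF z']] e(2)[OF z'] by (auto simp: y_def)
    qed
    then have "\<bar>r (a i) - r (b i)\<bar> = norm (D q i)" if "i \<in> I" for i
      using that ny unfolding Ds by (metis eq_iff_diff_eq_0 mult.right_neutral norm_scaleR)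
    then show ?thesis using nq tree by (intro exI[of _ r]) simp
  qed
  then obtain \<rho> where \<rho>: "\<And>z z'. z \<in> N \<Longrightarrow> z' \<in> N \<Longrightarrow>
        \<rho> z (a (e z')) - \<rho> z (b (e z')) = (if z' = z then 1 else 0 :: real)"
      "\<And>z i. z \<in> N \<Longrightarrow> i \<in> I \<Longrightarrow> \<bar>\<rho> z (a i) - \<rho> z (b i)\<bar> = (if z \<in> P i then 1 else 0)"
    by metis
  define \<beta> where "\<beta> z i = \<rho> z (a i) - \<rho> z (b i)" for z i
  \<comment> \<open>Subtracting the interpolation of \<open>q\<close> by the dual potentials
    \<open>\<rho> z\<close> leaves a configuration that is 0 on all tree edges, to which
    \<open>vanish\<close> applies.\<close>
  have expand: "D q i = (\<Sum>z\<in>P i. \<beta> z i *\<^sub>R D q (e z))" if i: "i \<in> I" for q i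
  proof -
    define q' where "q' v = q v - (\<Sum>z\<in>N. \<rho> z v *\<^sub>R D q (e z))" for v
    have Dq': "D q' i = D q i - (\<Sum>z\<in>N. \<beta> z i *\<^sub>R D q (e z))" for i
      by (simp add: D_def q'_def \<beta>_def scaleR_left_diff_distrib sum_subtractf)
    have "D q' i = 0"
    proof (rule vanish[OF _ i])
      fix x assume x: "x \<in> N"
      have "(\<Sum>z\<in>N. \<beta> z (e x) *\<^sub>R D q (e z)) = (\<Sum>z\<in>N. if x = z then D q (e z) else 0)"
        using \<rho>(1) x by (intro sum.cong) (auto simp: \<beta>_def)
      then show "D q' (e x) = 0" using x fin by (simp add: Dq' sum.delta')
    qed
    then have "D q i = (\<Sum>z\<in>N. \<beta> z i *\<^sub>R D q (e z))" by (simp add: Dq')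
    also have "\<dots> = (\<Sum>z\<in>P i. \<beta> z i *\<^sub>R D q (e z))"
    proof (intro sum.mono_neutral_right ballI)
      fix z assume "z \<in> N - P i"
      then show "\<beta> z i *\<^sub>R D q (e z) = 0" using \<rho>(2)[OF _ i, of z] by (simp add: \<beta>_def)
    qed (use fin P[OF i] in auto)
    finally show ?thesis .
  qed
  \<comment> \<open>With \<open>h\<close> on every tree edge, the length of edge \<open>i\<close> is
    \<open>card (P i)\<close>, the most that so many unit vectors can reach.\<close>
  obtain q0 where q0: "\<And>i. i \<in> I \<Longrightarrow> norm (D q0 i) = norm (\<Sum>z\<in>P i. h)"
    using forth[of "\<lambda>_. h"] unfolding D_def by blast
  \<comment> \<open>Tree edge vectors of \<open>q0\<close> are shown parallel only along a common
    path \<open>P i\<close>, so the sign is chosen by \<open>vec_sign\<close> and not by one fixed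
    direction. If \<open>P i\<close> is empty, the vector and its sign are 0.\<close>
  define \<epsilon> where "\<epsilon> i = vec_sign (D q0 i)" for i
  have nq0: "norm (D q0 i) = card (P i)" if "i \<in> I" for i
    using q0[OF that] h by (simp add: sum_constant_scaleR del: sum_constant)
  have abs_eps: "\<bar>\<epsilon> i\<bar> = 1" if "i \<in> I" "P i \<noteq> {}" for i
    using nq0[OF that(1)] finP[OF that(1)] that(2)
    by (auto simp: \<epsilon>_def intro!: abs_vec_sign)
  \<comment> \<open>Sharpness makes \<open>D q0 i\<close> a positive multiple of
    \<open>\<beta> z i *\<^sub>R D q0 (e z)\<close>; comparing signs yields the coefficient.\<close>
  have \<beta>: "\<beta> z i = \<epsilon> i * \<epsilon> (e z)" if i: "i \<in> I" and z: "z \<in> P i" for i z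
  proof -
    have zN: "z \<in> N" using P[OF i] z by blast
    have ab: "\<bar>\<beta> x i\<bar> = 1" if "x \<in> P i" for x
      using \<rho>(2)[OF _ i] P[OF i] that by (auto simp: \<beta>_def)
    have "D q0 i = real (card (P i)) *\<^sub>R (\<beta> z i *\<^sub>R D q0 (e z))"
      unfolding expand[OF i]
    proof (rule sum_unit_vectors_eq[OF finP[OF i] _ _ z])
      fix x assume x: "x \<in> P i"
      then have "x \<in> N" using P[OF i] by blast
      then have "norm (D q0 (e x)) = 1" using nq0[OF e(1)] e(2) by simp
      then show "norm (\<beta> x i *\<^sub>R D q0 (e x)) = 1" using ab[OF x] by simp
    next
      show "norm (\<Sum>z\<in>P i. \<beta> z i *\<^sub>R D q0 (e z)) = card (P i)"
        using nq0[OF i] expand[OF i] by metis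
    qed
    then have "\<epsilon> i = sgn (real (card (P i))) * (sgn (\<beta> z i) * \<epsilon> (e z))"
      unfolding \<epsilon>_def by (metis vec_sign_scaleR)
    moreover have "card (P i) > 0" using z finP[OF i] by (auto simp: card_gt_0_iff)
    moreover have "sgn (\<beta> z i) = \<beta> z i" using ab[OF z] by (auto simp: abs_if split: if_splits)
    ultimately have "\<epsilon> i = \<beta> z i * \<epsilon> (e z)" by simp
    moreover have "\<epsilon> (e z) * \<epsilon> (e z) = 1"
      using abs_eps[OF e(1)[OF zN]] e(2)[OF zN] by (auto simp: abs_if split: if_splits)
    ultimately show ?thesis by simp
  qed
  show thesis
  proof (rule that[of \<epsilon> \<rho>])
    fix z i assume "z \<in> N" "i \<in> I"
    then show "\<rho> z (a i) - \<rho> z (b i) = (if z \<in> P i then \<epsilon> i * \<epsilon> (e z) else 0)"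
      using \<beta>[of i z] \<rho>(2)[of z i] by (auto simp: \<beta>_def)
  next
    fix q :: "'w \<Rightarrow> real" and i assume i: "i \<in> I"
    \<comment> \<open>A real-valued \<open>q\<close> is placed on the line through \<open>h\<close>
      and read off again by the inner product with \<open>h\<close>.\<close>
    have Dh: "D (\<lambda>v. q v *\<^sub>R h) j \<bullet> h = q (a j) - q (b j)" for j
      using h by (simp add: D_def dot_square_norm flip: scaleR_left_diff_distrib)
    have "q (a i) - q (b i) = (\<Sum>z\<in>P i. \<beta> z i *\<^sub>R D (\<lambda>v. q v *\<^sub>R h) (e z)) \<bullet> h"
      by (simp flip: Dh expand[OF i])
    also have "\<dots> = (\<Sum>z\<in>P i. \<epsilon> i * (\<epsilon> (e z) * (q (a (e z)) - q (b (e z)))))"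
      using \<beta>[OF i] by (auto simp: inner_sum_left Dh intro!: sum.cong)
    finally show "q (a i) - q (b i) = \<epsilon> i * (\<Sum>z\<in>P i. \<epsilon> (e z) * (q (a (e z)) - q (b (e z))))"
      by (simp add: sum_distrib_left)
  qed (use abs_eps in auto)
qed

section \<open>Transfer of length sets between dimensions\<close>

text \<open>The signs and potentials found in dimension \<open>'d1\<close> are real numbers, so they
  act on vectors of \<open>real ^ 'd2\<close> as well. Each edge vector becomes
  \<open>\<epsilon> i\<close> times a path sum, and the sign does not change its norm.\<close>

lemma length_sets_transfer:
  fixes a b :: "'i \<Rightarrow> 'w" and P :: "'i \<Rightarrow> 'v set"
    and c :: "'v \<Rightarrow> real ^ 'd2" and q :: "'w \<Rightarrow> real ^ 'd2"
  assumes fin: "finite N" and P: "\<And>i. i \<in> I \<Longrightarrow> P i \<subseteq> N"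
    and e: "\<And>z. z \<in> N \<Longrightarrow> e z \<in> I" "\<And>z. z \<in> N \<Longrightarrow> P (e z) = {z}"
    and forth: "\<And>c :: 'v \<Rightarrow> real ^ 'd1. \<exists>q :: 'w \<Rightarrow> real ^ 'd1.
      \<forall>i\<in>I. norm (q (a i) - q (b i)) = norm (\<Sum>z\<in>P i. c z)"
    and conv: "\<And>q :: 'w \<Rightarrow> real ^ 'd1. \<exists>c :: 'v \<Rightarrow> real ^ 'd1.
      \<forall>i\<in>I. norm (q (a i) - q (b i)) = norm (\<Sum>z\<in>P i. c z)"
  shows "\<exists>q :: 'w \<Rightarrow> real ^ 'd2. \<forall>i\<in>I. norm (q (a i) - q (b i)) = norm (\<Sum>z\<in>P i. c z)"
    and "\<exists>c :: 'v \<Rightarrow> real ^ 'd2. \<forall>i\<in>I. norm (q (a i) - q (b i)) = norm (\<Sum>z\<in>P i. c z)"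
proof -
  obtain \<epsilon> :: "'i \<Rightarrow> real" and \<rho> :: "'v \<Rightarrow> 'w \<Rightarrow> real" where
    \<epsilon>: "\<And>i. i \<in> I \<Longrightarrow> P i \<noteq> {} \<Longrightarrow> \<bar>\<epsilon> i\<bar> = 1"
    and \<rho>: "\<And>z i. z \<in> N \<Longrightarrow> i \<in> I \<Longrightarrow> \<rho> z (a i) - \<rho> z (b i) = (if z \<in> P i then \<epsilon> i * \<epsilon> (e z) else 0)"
    and rel: "\<And>(q :: 'w \<Rightarrow> real) i. i \<in> I \<Longrightarrow>
       q (a i) - q (b i) = \<epsilon> i * (\<Sum>z\<in>P i. \<epsilon> (e z) * (q (a (e z)) - q (b (e z))))"
    by (rule relations_rigid[OF fin P e forth conv]) (assumption+, rule that)
  have \<epsilon>2: "\<epsilon> (e z) * \<epsilon> (e z) = 1" if "z \<in> N" for z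
    using \<epsilon>[OF e(1)[OF that]] e(2)[OF that] by (auto simp: abs_if split: if_splits)
  \<comment> \<open>For empty \<open>P i\<close> nothing is known about \<open>\<epsilon> i\<close>,
    but then the sum is 0.\<close>
  have norm_eps: "norm (\<epsilon> i *\<^sub>R (\<Sum>z\<in>P i. c z)) = norm (\<Sum>z\<in>P i. c z)"
    if "i \<in> I" for i and c :: "'v \<Rightarrow> real ^ 'd2"
    using \<epsilon>[OF that] by (cases "P i = {}") auto
  show "\<exists>q :: 'w \<Rightarrow> real ^ 'd2. \<forall>i\<in>I. norm (q (a i) - q (b i)) = norm (\<Sum>z\<in>P i. c z)"
  proof (intro exI ballI)
    fix i assume i: "i \<in> I"
    \<comment> \<open>The dual potentials assemble a configuration whose vector on tree edge
      \<open>e z\<close> is \<open>\<epsilon> (e z) *\<^sub>R c z\<close>.\<close>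
    let ?q = "\<lambda>v. \<Sum>z\<in>N. \<rho> z v *\<^sub>R \<epsilon> (e z) *\<^sub>R c z"
    have "?q (a i) - ?q (b i) = (\<Sum>z\<in>N. (\<rho> z (a i) - \<rho> z (b i)) *\<^sub>R \<epsilon> (e z) *\<^sub>R c z)"
      by (simp only: scaleR_left_diff_distrib sum_subtractf)
    also have "\<dots> = (\<Sum>z\<in>P i. (\<rho> z (a i) - \<rho> z (b i)) *\<^sub>R \<epsilon> (e z) *\<^sub>R c z)"
      using fin P[OF i] \<rho>[OF _ i] by (intro sum.mono_neutral_right) auto
    also have "\<dots> = (\<Sum>z\<in>P i. \<epsilon> i *\<^sub>R c z)"
      using \<rho>[OF _ i] P[OF i] \<epsilon>2 by (intro sum.cong) (auto simp: mult.assoc subset_iff)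
    also have "\<dots> = \<epsilon> i *\<^sub>R (\<Sum>z\<in>P i. c z)"
      by (simp add: scaleR_sum_right)
    finally show "norm (?q (a i) - ?q (b i)) = norm (\<Sum>z\<in>P i. c z)"
      by (simp only: norm_eps[OF i])
  qed
  show "\<exists>c :: 'v \<Rightarrow> real ^ 'd2. \<forall>i\<in>I. norm (q (a i) - q (b i)) = norm (\<Sum>z\<in>P i. c z)"
  proof (intro exI ballI)
    fix i assume i: "i \<in> I"
    let ?c = "\<lambda>z. \<epsilon> (e z) *\<^sub>R (q (a (e z)) - q (b (e z)))"
    have "q (a i) - q (b i) = \<epsilon> i *\<^sub>R (\<Sum>z\<in>P i. ?c z)"
      unfolding vec_eq_iff using rel[OF i, of "\<lambda>v. q v $ k" for k] by simp
    then show "norm (q (a i) - q (b i)) = norm (\<Sum>z\<in>P i. ?c z)"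
      by (simp only: norm_eps[OF i])
  qed
qed

section \<open>Measurement sets\<close>

text \<open>Edges lie inside \<open>verts G\<close>, so restricting a map to the vertices changes no
  edge length, and \<open>p\<close> may range over all functions.\<close>

lemma measurement_set_eq:
  assumes "\<And>i. i < card (edges G) \<Longrightarrow> \<sigma> i = {u i, w i}"
    and "\<And>i. i < card (edges G) \<Longrightarrow> \<sigma> i \<subseteq> verts G"
  shows "measurement_set TYPE('d::finite) G \<sigma> =
    range (\<lambda>(p :: 'v \<Rightarrow> real ^ 'd). \<lambda>i\<in>{..<card (edges G)}. (norm (p (u i) - p (w i)))\<^sup>2)"
    (is "_ = range ?L")
proof -
  have L: "length_squared G \<sigma> p = ?L p" for p :: "'v \<Rightarrow> real ^ 'd"
    unfolding length_squared_def using assms(1) sq_length_doubleton by (intro restrict_ext) auto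
  have "?L p \<in> ?L ` configurations (verts G)" for p :: "'v \<Rightarrow> real ^ 'd"
  proof (rule image_eqI)
    show "restrict p (verts G) \<in> configurations (verts G)" by (simp add: configurations_def)
    show "?L p = ?L (restrict p (verts G))" using assms by (intro restrict_ext) auto
  qed
  then show ?thesis unfolding measurement_set_def L by blast
qed

text \<open>Norms are nonnegative, so squaring loses nothing; equality of measurement sets becomes
  the two matching conditions used for rigidity and transfer.\<close>

lemma range_sq_eq_iff:
  fixes f :: "'a \<Rightarrow> 'i \<Rightarrow> 'c::real_normed_vector" and g :: "'b \<Rightarrow> 'i \<Rightarrow> 'c"
  shows "range (\<lambda>p. \<lambda>i\<in>I. (norm (f p i))\<^sup>2) = range (\<lambda>q. \<lambda>i\<in>I. (norm (g q i))\<^sup>2) \<longleftrightarrow>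
    (\<forall>p. \<exists>q. \<forall>i\<in>I. norm (g q i) = norm (f p i)) \<and> (\<forall>q. \<exists>p. \<forall>i\<in>I. norm (g q i) = norm (f p i))"
proof -
  have "(\<lambda>i\<in>I. (norm (f p i))\<^sup>2) = (\<lambda>i\<in>I. (norm (g q i))\<^sup>2) \<longleftrightarrow> (\<forall>i\<in>I. norm (g q i) = norm (f p i))"
    for p q by (auto simp: fun_eq_iff restrict_def)
  then show ?thesis
    by (simp add: set_eq_subset image_subset_iff image_iff) metis
qed

text \<open>Tree edge vectors can be prescribed freely and determine all others, so they parametrize
  the measurement set. The real-valued \<open>path\<close> and \<open>free\<close> are applied to
  each coordinate.\<close>

lemma measurement_set_dfs:
  fixes u w :: "nat \<Rightarrow> 'v" and P :: "nat \<Rightarrow> 'v set"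
  assumes \<sigma>: "\<And>i. i < card (edges G) \<Longrightarrow> \<sigma> i = {u i, w i}"
      "\<And>i. i < card (edges G) \<Longrightarrow> \<sigma> i \<subseteq> verts G"
    and P: "\<And>i. i < card (edges G) \<Longrightarrow> P i \<subseteq> N"
    and path: "\<And>i (p :: 'v \<Rightarrow> real). i < card (edges G) \<Longrightarrow>
      p (u i) - p (w i) = (\<Sum>z\<in>P i. p (u (e z)) - p (w (e z)))"
    and free: "\<And>c :: 'v \<Rightarrow> real. \<exists>p. \<forall>z\<in>N. p (u (e z)) - p (w (e z)) = c z"
  shows "measurement_set TYPE('d::finite) G \<sigma> =
    range (\<lambda>(c :: 'v \<Rightarrow> real ^ 'd). \<lambda>i\<in>{..<card (edges G)}. (norm (\<Sum>z\<in>P i. c z))\<^sup>2)"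
proof -
  have vpath: "p (u i) - p (w i) = (\<Sum>z\<in>P i. p (u (e z)) - p (w (e z)))"
    if "i < card (edges G)" for i and p :: "'v \<Rightarrow> real ^ 'd"
    unfolding vec_eq_iff using path[OF that, of "\<lambda>v. p v $ k" for k] by simp
  have vfree: "\<exists>p. \<forall>z\<in>N. p (u (e z)) - p (w (e z)) = c z" for c :: "'v \<Rightarrow> real ^ 'd"
  proof -
    obtain p where "\<And>k z. z \<in> N \<Longrightarrow> p k (u (e z)) - p k (w (e z)) = c z $ k"
      using free[of "\<lambda>z. c z $ k" for k] by metis
    then show ?thesis by (intro exI[of _ "\<lambda>v. \<chi> k. p k v"]) (simp add: vec_eq_iff)
  qed
  have "\<exists>c :: 'v \<Rightarrow> real ^ 'd. \<forall>i\<in>{..<card (edges G)}. norm (\<Sum>z\<in>P i. c z) = norm (p (u i) - p (w i))"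
    for p :: "'v \<Rightarrow> real ^ 'd"
    using arg_cong[OF vpath[symmetric], of _ norm p]
    by (intro exI[of _ "\<lambda>z. p (u (e z)) - p (w (e z))"]) (auto simp del: sum_subtractf)
  moreover have "\<exists>p :: 'v \<Rightarrow> real ^ 'd. \<forall>i\<in>{..<card (edges G)}. norm (\<Sum>z\<in>P i. c z) = norm (p (u i) - p (w i))"
    for c :: "'v \<Rightarrow> real ^ 'd"
  proof -
    obtain p where p: "\<forall>z\<in>N. p (u (e z)) - p (w (e z)) = c z" using vfree by blast
    have "p (u i) - p (w i) = (\<Sum>z\<in>P i. c z)" if "i < card (edges G)" for i
      unfolding vpath[OF that] using p P[OF that] by (intro sum.cong) auto
    then show ?thesis by (intro exI[of _ p]) simp
  qed
  moreover have "measurement_set TYPE('d::finite) G \<sigma> =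
      range (\<lambda>(p :: 'v \<Rightarrow> real ^ 'd). \<lambda>i\<in>{..<card (edges G)}. (norm (p (u i) - p (w i)))\<^sup>2)"
    by (rule measurement_set_eq) (use \<sigma> in auto)
  ultimately show ?thesis
    by (simp only: range_sq_eq_iff) blast
qed

theorem corollary1p11:
  fixes \<Gamma> :: "'v ugraph" and \<Delta> :: "'w ugraph"
  assumes "finite_simple_graph \<Gamma>" and "finite_simple_graph \<Delta>"
    and "measurement_isomorphic TYPE('d1::finite) \<Gamma> \<Delta>"
  shows "measurement_isomorphic TYPE('d2::finite) \<Gamma> \<Delta>"
proof -
  obtain \<sigma> \<tau> where card: "card (edges \<Gamma>) = card (edges \<Delta>)"
    and \<sigma>: "edge_labelling \<Gamma> \<sigma>" and \<tau>: "edge_labelling \<Delta> \<tau>"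
    and eq: "measurement_set TYPE('d1) \<Gamma> \<sigma> = measurement_set TYPE('d1) \<Delta> \<tau>"
    using assms(3) unfolding measurement_isomorphic_def by blast
  define I where "I = {..<card (edges \<Gamma>)}"
  have bij: "bij_betw \<sigma> I (edges \<Gamma>)" "bij_betw \<tau> I (edges \<Delta>)"
    using \<sigma> \<tau> card by (simp_all add: edge_labelling_def I_def)
  have V: "finite (verts \<Gamma>)" "edges \<Gamma> \<subseteq> {A. A \<subseteq> verts \<Gamma> \<and> card A = 2}"
    and W: "edges \<Delta> \<subseteq> {A. A \<subseteq> verts \<Delta> \<and> card A = 2}"
    using assms(1,2) by (auto simp: finite_simple_graph_def)
  obtain u w :: "nat \<Rightarrow> 'v" and N P e where N: "finite N"
    and uw: "\<And>i. i \<in> I \<Longrightarrow> \<sigma> i = {u i, w i}" and P: "\<And>i. i \<in> I \<Longrightarrow> P i \<subseteq> N"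
    and e: "\<And>z. z \<in> N \<Longrightarrow> e z \<in> I" "\<And>z. z \<in> N \<Longrightarrow> P (e z) = {z}"
    and path: "\<And>i (p :: 'v \<Rightarrow> real). i \<in> I \<Longrightarrow>
      p (u i) - p (w i) = (\<Sum>z\<in>P i. p (u (e z)) - p (w (e z)))"
    and free: "\<And>c :: 'v \<Rightarrow> real. \<exists>p. \<forall>z\<in>N. p (u (e z)) - p (w (e z)) = c z"
    by (rule dfs_coordinates[OF V(1) bij(1) V(2)]) (rule that)
  \<comment> \<open>The edges of \<open>\<Delta>\<close> are oriented arbitrarily; the signs in
    \<open>relations_rigid\<close> absorb the choice.\<close>
  have "\<exists>a b. \<tau> i = {a, b}" if "i \<in> I" for i
    using bij_betwE[OF bij(2)] W that by (blast dest: card_2_iff[THEN iffD1])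
  then obtain a b where ab: "\<And>i. i \<in> I \<Longrightarrow> \<tau> i = {a i, b i}" by metis
  have sub: "\<And>i. i \<in> I \<Longrightarrow> \<sigma> i \<subseteq> verts \<Gamma>" "\<And>i. i \<in> I \<Longrightarrow> \<tau> i \<subseteq> verts \<Delta>"
    using bij_betwE[OF bij(1)] bij_betwE[OF bij(2)] V(2) W by blast+
  \<comment> \<open>This and the next description hold for every \<open>'d\<close>: they are read at
    \<open>'d1\<close> to unpack the hypothesis and at \<open>'d2\<close> to reach the conclusion,
    with the same labellings.\<close>
  have \<Gamma>: "measurement_set TYPE('d::finite) \<Gamma> \<sigma> =
      range (\<lambda>(c :: 'v \<Rightarrow> real ^ 'd). \<lambda>i\<in>I. (norm (\<Sum>z\<in>P i. c z))\<^sup>2)"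
    unfolding I_def
    by (rule measurement_set_dfs[where N = N and e = e]) (use uw sub P path free in \<open>auto simp: I_def\<close>)
  have \<Delta>: "measurement_set TYPE('d::finite) \<Delta> \<tau> =
      range (\<lambda>(q :: 'w \<Rightarrow> real ^ 'd). \<lambda>i\<in>I. (norm (q (a i) - q (b i)))\<^sup>2)"
    unfolding I_def card
    by (rule measurement_set_eq) (use ab sub card in \<open>auto simp: I_def\<close>)
  have "\<forall>c :: 'v \<Rightarrow> real ^ 'd1. \<exists>q :: 'w \<Rightarrow> real ^ 'd1.
          \<forall>i\<in>I. norm (q (a i) - q (b i)) = norm (\<Sum>z\<in>P i. c z)"
    and "\<forall>q :: 'w \<Rightarrow> real ^ 'd1. \<exists>c :: 'v \<Rightarrow> real ^ 'd1.
          \<forall>i\<in>I. norm (q (a i) - q (b i)) = norm (\<Sum>z\<in>P i. c z)"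
    using eq unfolding \<Gamma> \<Delta> range_sq_eq_iff by blast+
  note transfer = length_sets_transfer[OF N P e this[rule_format]]
  have "measurement_set TYPE('d2) \<Gamma> \<sigma> = measurement_set TYPE('d2) \<Delta> \<tau>"
    unfolding \<Gamma> \<Delta> range_sq_eq_iff using transfer by blast
  then show ?thesis
    using card \<sigma> \<tau> unfolding measurement_isomorphic_def by blast
qed

end
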